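(* Let $(v_j,\sigma_j^2)_j$ be the eigenvectors and eigenvalues of $A=\mathcal{A}^*\mathcal{A}$, let $L\in[0,1)$ and let $\varphi_\theta=\mathrm{Id}-f_\theta$ be an iResNet which solves the training problem $$\min_{\theta\in\Theta}\ \frac1N\sum_{i=1}^N\|\varphi_\theta(x^{(i)})-Ax^{(i)}\|^2\quad\text{s.t. }\mathrm{Lip}(f_\theta)\leqslant L,$$ where (i) $f_\theta(x)=\phi(Wx)$ with $\theta=W$, $\Theta=\{W\in L(X)\mid\exists (w_j)_{j\in\mathbb{N}}:\ W=\sum_{j\in\mathbb{N}}w_j\langle\cdot,v_j\rangle v_j\}$, and $\phi$ is the ReLU function with respect to the eigenvectors, i.e. $\phi(x)=\sum_{j\in\mathbb{N}}\max(0,\langle v_j,x\rangle)v_j$, (ii) for every eigenvector $v_j$ of $A$, the training dataset $\{x^{(i)}\}_{i\in\{1,\dots,N\}}\subset X$ contains at least one $x^{(i)}$ such that $\langle x^{(i)},v_j\rangle>0$. Then the solution of the training problem is $W=\sum_{j\in\mathbb{N}}w_j\langle\cdot,v_j\rangle v_j$ with $w_j=\min\{1-\sigma_j^2,L\}$, and for $z\in\mathcal{R}(\mathcal{A}^* )$ $$\varphi_\theta^{-1}(z)=\sum_{j\in\mathbb{N}}r_L(\sigma_j^2,\langle z,v_j\rangle)\,\langle z,v_j\rangle\,v_j$$ holds with $$r_L(\sigma^2,s)=\begin{cases}\dfrac{1}{\max\{\sigma^2,1-L\}}&\text{if }s\geqslant0,\\[1ex]1&\text{if }s<0.\end{cases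}$$
   Context: $X,Y$ are Hilbert spaces and $\mathcal{A}:X\to Y$ is a bounded linear operator with $\|\mathcal{A}\|=1$. $\mathcal{A}$ is assumed to have a singular value decomposition $(u_j,v_j,\sigma_j)_{j\in\mathbb{N}}$ (finitely many $j$ if the range is finite-dimensional), i.e. $\mathcal{A}x=\sum_j\sigma_j\langle x,v_j\rangle u_j$ with $\sigma_j>0$, $(u_j)$ orthonormal in $Y$ and $(v_j)$ an orthonormal basis of $\mathcal{N}(\mathcal{A})^\perp$; hence $\sigma_j\in(0,1]$, and $(v_j,\sigma_j^2)$ are the eigenvectors and (non-zero) eigenvalues of $A=\mathcal{A}^*\mathcal{A}$. $\mathcal{N}$ and $\mathcal{R}$ denote null space and range, $L(X)$ denotes the bounded linear operators on $X$ (not to be confused with the number $L$), and $\mathrm{Lip}(f)$ the Lipschitz constant of $f:X\to X$. An iResNet is a map $\varphi_\theta=\mathrm{Id}-f_\theta:X\to X$ with $\mathrm{Lip}(f_\theta)\leqslant L<1$; it is bijective on $X$.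
   Formalization: The solution is not unique if L>0 and some σ_j=1 has ⟨x^(i),v_j⟩≥0 for all i: there any w_j∈[−L,0] is optimal. The given W is shown to solve the problem with the stated inverse; that every solution equals W is claimed only without such j, otherwise for the other w_j and for z with ⟨z,v_j⟩≥0. *)

theory Defs
  imports "HOL-Analysis.Analysis"
begin

definition orthonormal_family :: "nat set \<Rightarrow> (nat \<Rightarrow> 'a::real_inner) \<Rightarrow> bool" where
  "orthonormal_family J e \<longleftrightarrow> (\<forall>i\<in>J. \<forall>j\<in>J. e i \<bullet> e j = (if i = j then 1 else 0))"

text \<open>The index set \<open>J\<close> is all of \<open>\<nat>\<close> for an operator with infinite-dimensional
  range and a finite set of indices otherwise.\<close>

definition singular_value_decomposition ::
  "('a::real_inner \<Rightarrow>\<^sub>L 'b::real_inner) \<Rightarrow> nat set \<Rightarrow> (nat \<Rightarrow> 'b) \<Rightarrow> (nat \<Rightarrow> 'a) \<Rightarrow> (nat \<Rightarrow> real) \<Rightarrow> bool"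
where
  "singular_value_decomposition \<A> J u v \<sigma> \<longleftrightarrow>
     (\<forall>j\<in>J. 0 < \<sigma> j) \<and>
     orthonormal_family J u \<and>
     orthonormal_family J v \<and>
     closure (span (v ` J)) = orthogonal_comp {x. blinfun_apply \<A> x = 0} \<and>
     (\<forall>x. ((\<lambda>j. (\<sigma> j * (x \<bullet> v j)) *\<^sub>R u j) has_sum blinfun_apply \<A> x) J)"

definition normal_op :: "('a::real_inner \<Rightarrow>\<^sub>L 'b::real_inner) \<Rightarrow> 'a \<Rightarrow> 'a" where
  "normal_op \<A> x = adjoint (blinfun_apply \<A>) (blinfun_apply \<A> x)"

text \<open>The series \<open>W = \<Sum>\<^sub>j w\<^sub>j \<langle>\<cdot>, v\<^sub>j\<rangle> v\<^sub>j\<close> is understood pointwise (strongly): it need not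
  converge in operator norm, e.g. when all \<open>w\<^sub>j\<close> are equal.\<close>

definition diagonal_op ::
  "nat set \<Rightarrow> (nat \<Rightarrow> 'a::real_inner) \<Rightarrow> (nat \<Rightarrow> real) \<Rightarrow> ('a \<Rightarrow>\<^sub>L 'a) \<Rightarrow> bool"
where
  "diagonal_op J v w W \<longleftrightarrow>
     (\<forall>x. ((\<lambda>j. (w j * (x \<bullet> v j)) *\<^sub>R v j) has_sum blinfun_apply W x) J)"

definition parameters :: "nat set \<Rightarrow> (nat \<Rightarrow> 'a::real_inner) \<Rightarrow> ('a \<Rightarrow>\<^sub>L 'a) set" where
  "parameters J v = {W. \<exists>w. diagonal_op J v w W}"

definition relu :: "nat set \<Rightarrow> (nat \<Rightarrow> 'a::real_inner) \<Rightarrow> 'a \<Rightarrow> 'a" where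
  "relu J v x = (\<Sum>\<^sub>\<infinity>j\<in>J. max 0 (v j \<bullet> x) *\<^sub>R v j)"

definition residual :: "nat set \<Rightarrow> (nat \<Rightarrow> 'a::real_inner) \<Rightarrow> ('a \<Rightarrow>\<^sub>L 'a) \<Rightarrow> 'a \<Rightarrow> 'a" where
  "residual J v W x = relu J v (blinfun_apply W x)"

definition iresnet :: "nat set \<Rightarrow> (nat \<Rightarrow> 'a::real_inner) \<Rightarrow> ('a \<Rightarrow>\<^sub>L 'a) \<Rightarrow> 'a \<Rightarrow> 'a" where
  "iresnet J v W x = x - residual J v W x"

definition training_loss ::
  "('a::real_inner \<Rightarrow>\<^sub>L 'b::real_inner) \<Rightarrow> nat set \<Rightarrow> (nat \<Rightarrow> 'a) \<Rightarrow> nat \<Rightarrow> (nat \<Rightarrow> 'a) \<Rightarrow> ('a \<Rightarrow>\<^sub>L 'a) \<Rightarrow> real"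
where
  "training_loss \<A> J v N xs W =
     (1 / real N) * (\<Sum>i=1..N. (norm (iresnet J v W (xs i) - normal_op \<A> (xs i)))\<^sup>2)"

definition solves_training ::
  "('a::real_inner \<Rightarrow>\<^sub>L 'b::real_inner) \<Rightarrow> nat set \<Rightarrow> (nat \<Rightarrow> 'a) \<Rightarrow> real \<Rightarrow> nat \<Rightarrow> (nat \<Rightarrow> 'a) \<Rightarrow> ('a \<Rightarrow>\<^sub>L 'a) \<Rightarrow> bool"
where
  "solves_training \<A> J v L N xs =
     is_arg_min (training_loss \<A> J v N xs)
       (\<lambda>W. W \<in> parameters J v \<and> L-lipschitz_on UNIV (residual J v W))"

definition r_filter :: "real \<Rightarrow> real \<Rightarrow> real \<Rightarrow> real" where
  "r_filter L a s = (if s \<ge> 0 then 1 / max a (1 - L) else 1)"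

definition inverse_formula :: "nat set \<Rightarrow> (nat \<Rightarrow> 'a::real_inner) \<Rightarrow> (nat \<Rightarrow> real) \<Rightarrow> real \<Rightarrow> ('a \<Rightarrow>\<^sub>L 'a) \<Rightarrow> 'a \<Rightarrow> bool"
where
  "inverse_formula J v \<sigma> L W z \<longleftrightarrow>
     ((\<lambda>j. (r_filter L ((\<sigma> j)\<^sup>2) (z \<bullet> v j) * (z \<bullet> v j)) *\<^sub>R v j)
        has_sum inv (iresnet J v W) z) J"

text \<open>If \<open>\<sigma>\<^sub>j = 1\<close>, the target for the \<open>j\<close>-th component of \<open>residual\<close> is zero. When moreover no
  sample has a negative \<open>j\<close>-th coefficient, then every \<open>w\<^sub>j \<in> [-L, 0]\<close> attains it on the data,
  so for \<open>L > 0\<close> the training problem does not determine \<open>w\<^sub>j\<close>.\<close>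

definition undetermined ::
  "nat set \<Rightarrow> (nat \<Rightarrow> 'a::real_inner) \<Rightarrow> (nat \<Rightarrow> real) \<Rightarrow> real \<Rightarrow> nat \<Rightarrow> (nat \<Rightarrow> 'a) \<Rightarrow> nat set"
where
  "undetermined J v \<sigma> L N xs =
     {j \<in> J. 0 < L \<and> \<sigma> j = 1 \<and> (\<forall>i\<in>{1..N}. 0 \<le> xs i \<bullet> v j)}"

end

theory Submission
  imports Defs
begin

text \<open>Every object in the training problem is diagonal in the family \<open>v\<close>. With \<open>c = x \<bullet> v j\<close>,
  the residual maps \<open>c\<close> to \<open>max 0 (w j * c)\<close> and the normal operator maps \<open>c\<close> to \<open>(\<sigma> j)\<^sup>2 * c\<close>
  (\<open>residual_expansion\<close>, \<open>normal_op_expansion\<close>). By Parseval the loss is therefore a constant plus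
  a sum over \<open>j\<close> of losses that each involve the single number \<open>w j\<close> (\<open>training_loss_splits\<close>),
  and the Lipschitz constraint says exactly that \<open>\<bar>w j\<bar> \<le> L\<close> for every \<open>j\<close>
  (\<open>residual_lipschitz_iff\<close>). The problem decouples into scalar ones.

  In the scalar problem the target for the residual is \<open>t * c\<close> with \<open>t = 1 - (\<sigma> j)\<^sup>2 \<ge> 0\<close>. A sample
  with \<open>c > 0\<close> sees only the positive part of the weight and wants it as close to \<open>t\<close> as the bound
  \<open>L\<close> permits; a sample with \<open>c < 0\<close> has a nonpositive target and wants the ReLU to be inactive. The
  weight \<open>min t L\<close> is best for all samples at once (\<open>sample_term_minimal\<close>). A sample with \<open>c > 0\<close>
  fixes the positive part of a minimizer, so the only ambiguity is a negative weight when
  \<open>min t L = 0\<close>, and it survives only if no sample has \<open>c < 0\<close> (\<open>component_loss_minimizers\<close>);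
  the indices \<open>j\<close> where that occurs form the set \<open>undetermined\<close>.

  The network is a bijection by Banach's fixed point theorem, and its inverse is computed
  coefficient by coefficient: the scalar map \<open>c \<mapsto> c - max 0 (w * c)\<close> preserves the sign of \<open>c\<close>
  because \<open>w < 1\<close>, and for \<open>w \<ge> 0\<close> it is multiplication by \<open>1 - w\<close> on the positive half-line and
  the identity on the negative one. Points in the range of the adjoint have an expansion in \<open>v\<close>, and
  so do their preimages (\<open>inverse_formula_if\<close>).\<close>

section \<open>Expansions in orthonormal families\<close>

lemma orthonormal_expansion_coeff:
  assumes e: "orthonormal_family J e" and s: "((\<lambda>j. c j *\<^sub>R e j) has_sum s) J" and k: "k \<in> J"
  shows "s \<bullet> e k = c k"
proof -
  have "((\<lambda>j. (c j *\<^sub>R e j) \<bullet> e k) has_sum s \<bullet> e k) J"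
    by (rule has_sum_bounded_linear[OF bounded_linear_inner_left s])
  moreover have "((\<lambda>j. (c j *\<^sub>R e j) \<bullet> e k) has_sum c k) J"
    by (rule has_sum_finite_neutralI[of "{k}"])
       (use e k in \<open>auto simp: orthonormal_family_def\<close>)
  ultimately show ?thesis
    by (rule has_sum_unique)
qed

lemma parseval:
  assumes e: "orthonormal_family J e" and s: "((\<lambda>j. c j *\<^sub>R e j) has_sum s) J"
  shows "((\<lambda>j. (c j)\<^sup>2) has_sum (norm s)\<^sup>2) J"
proof -
  have "((\<lambda>j. (c j *\<^sub>R e j) \<bullet> s) has_sum s \<bullet> s) J"
    by (rule has_sum_bounded_linear[OF bounded_linear_inner_left s])
  also have "?this \<longleftrightarrow> ((\<lambda>j. (c j)\<^sup>2) has_sum s \<bullet> s) J"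
    by (rule has_sum_cong)
       (simp add: orthonormal_expansion_coeff[OF e s] inner_commute[of _ s] power2_eq_square)
  finally show ?thesis
    by (simp add: power2_norm_eq_inner)
qed

lemma norm_finite_orthonormal_sum:
  assumes "orthonormal_family J e" "finite F" "F \<subseteq> J"
  shows "(norm (\<Sum>j\<in>F. c j *\<^sub>R e j))\<^sup>2 = (\<Sum>j\<in>F. (c j)\<^sup>2)"
proof -
  have "orthonormal_family F e"
    using assms(1,3) unfolding orthonormal_family_def by blast
  from parseval[OF this has_sum_finite[OF assms(2)], of c]
  show ?thesis
    using assms(2) by (metis has_sum_finite has_sum_unique)
qed

lemma bessel_inequality:
  assumes e: "orthonormal_family J e" and F: "finite F" "F \<subseteq> J"
  shows "(\<Sum>j\<in>F. (x \<bullet> e j)\<^sup>2) \<le> (norm x)\<^sup>2"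
proof -
  define y where "y = (\<Sum>j\<in>F. (x \<bullet> e j) *\<^sub>R e j)"
  have y: "y \<bullet> y = (\<Sum>j\<in>F. (x \<bullet> e j)\<^sup>2)"
    using norm_finite_orthonormal_sum[OF e F] by (simp add: y_def power2_norm_eq_inner)
  have "x \<bullet> y = (\<Sum>j\<in>F. (x \<bullet> e j)\<^sup>2)"
    by (simp add: y_def inner_sum_right power2_eq_square)
  then have "(x - y) \<bullet> (x - y) = x \<bullet> x - (\<Sum>j\<in>F. (x \<bullet> e j)\<^sup>2)"
    by (simp add: y inner_diff_left inner_diff_right inner_commute[of y x])
  then show ?thesis
    by (smt (verit) inner_ge_zero power2_norm_eq_inner)
qed

text \<open>Partial sums over finite sets form a Cauchy filter, because by Pythagoras the distance of two
  nested ones is a tail of the convergent series of squares.\<close>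

lemma riesz_fischer:
  fixes e :: "nat \<Rightarrow> 'a::{real_inner, complete_space}"
  assumes e: "orthonormal_family J e" and c: "(\<lambda>j. (c j)\<^sup>2) summable_on J"
  shows "(\<lambda>j. c j *\<^sub>R e j) summable_on J"
proof -
  define S where "S = (\<Sum>\<^sub>\<infinity>j\<in>J. (c j)\<^sup>2)"
  let ?f = "\<lambda>j. c j *\<^sub>R e j" and ?q = "\<lambda>j. (c j)\<^sup>2"
  have S: "(?q has_sum S) J"
    using c by (simp add: S_def)
  have "\<exists>P. eventually P (finite_subsets_at_top J) \<and>
          (\<forall>F1 F2. P F1 \<and> P F2 \<longrightarrow> dist (sum ?f F1) (sum ?f F2) < \<epsilon>)" if "\<epsilon> > 0" for \<epsilon>
  proof -
    obtain F0 where F0: "finite F0" "F0 \<subseteq> J" and d: "dist (sum ?q F0) S \<le> (\<epsilon> / 3)\<^sup>2"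
      using has_sum_finite_approximation[OF S, of "(\<epsilon> / 3)\<^sup>2"] \<open>\<epsilon> > 0\<close> by auto
    define P where "P F \<longleftrightarrow> finite F \<and> F0 \<subseteq> F \<and> F \<subseteq> J" for F
    have "eventually P (finite_subsets_at_top J)"
      unfolding eventually_finite_subsets_at_top P_def using F0 by blast
    moreover have near: "dist (sum ?f F) (sum ?f F0) \<le> \<epsilon> / 3" if "P F" for F
    proof -
      have F: "finite F" "F0 \<subseteq> F" "F \<subseteq> J"
        using that by (auto simp: P_def)
      have "(dist (sum ?f F) (sum ?f F0))\<^sup>2 = (norm (sum ?f (F - F0)))\<^sup>2"
        using F by (simp add: dist_norm sum_diff)
      also have "\<dots> = sum ?q (F - F0)"
        using F by (intro norm_finite_orthonormal_sum[OF e]) auto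
      also have "\<dots> = sum ?q F - sum ?q F0"
        using F by (simp add: sum_diff)
      also have "\<dots> \<le> S - sum ?q F0"
        using finite_sum_le_has_sum[OF S F(1,3)] by simp
      also have "\<dots> \<le> (\<epsilon> / 3)\<^sup>2"
        using d by (simp add: dist_real_def)
      finally show ?thesis
        by (rule power2_le_imp_le) (use \<open>\<epsilon> > 0\<close> in simp)
    qed
    moreover have "dist (sum ?f F1) (sum ?f F2) < \<epsilon>" if "P F1" "P F2" for F1 F2
      using near[OF that(1)] near[OF that(2)] \<open>\<epsilon> > 0\<close>
        dist_triangle2[of "sum ?f F1" "sum ?f F2" "sum ?f F0"] by linarith
    ultimately show ?thesis
      by blast
  qed
  then have "cauchy_filter (filtermap (sum ?f) (finite_subsets_at_top J))"
    by (simp add: cauchy_filter_metric_filtermap)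
  moreover have "complete (UNIV :: 'a set)"
    by (meson Cauchy_convergent UNIV_I complete_def convergent_def)
  ultimately obtain s where "(sum ?f \<longlongrightarrow> s) (finite_subsets_at_top J)"
    using complete_uniform[where S=UNIV] by (force simp add: filterlim_def)
  then show ?thesis
    using summable_on_def has_sum_def by blast
qed

lemma dominated_square_sum_le:
  assumes f: "orthonormal_family J f" and F: "finite F" "F \<subseteq> J"
    and c: "\<And>j. j \<in> J \<Longrightarrow> \<bar>c j\<bar> \<le> K * \<bar>x \<bullet> f j\<bar>"
  shows "(\<Sum>j\<in>F. (c j)\<^sup>2) \<le> (K * norm x)\<^sup>2"
proof -
  have sq: "(c j)\<^sup>2 \<le> K\<^sup>2 * (x \<bullet> f j)\<^sup>2" if "j \<in> J" for j
    using power_mono[OF c[OF that], of 2] by (simp add: power_mult_distrib)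
  have "(\<Sum>j\<in>F. (c j)\<^sup>2) \<le> K\<^sup>2 * (\<Sum>j\<in>F. (x \<bullet> f j)\<^sup>2)"
    unfolding sum_distrib_left using F by (intro sum_mono sq) auto
  also have "\<dots> \<le> K\<^sup>2 * (norm x)\<^sup>2"
    by (intro mult_left_mono bessel_inequality[OF f F]) auto
  finally show ?thesis
    by (simp add: power_mult_distrib)
qed

text \<open>The next two facts carry all boundedness arguments below: a sequence that is pointwise
  dominated by the Fourier coefficients of some \<open>x\<close> is itself the coefficient sequence of a vector,
  of norm at most a multiple of \<open>norm x\<close>. Two orthonormal families are allowed, in possibly different
  spaces, because the adjoint turns coefficients with respect to the left singular vectors into
  coefficients with respect to the right ones.\<close>

lemma dominated_expansion_summable:
  fixes e :: "nat \<Rightarrow> 'a::{real_inner, complete_space}"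
  assumes e: "orthonormal_family J e" and f: "orthonormal_family J f"
    and c: "\<And>j. j \<in> J \<Longrightarrow> \<bar>c j\<bar> \<le> K * \<bar>x \<bullet> f j\<bar>"
  shows "(\<lambda>j. c j *\<^sub>R e j) summable_on J"
proof (rule riesz_fischer[OF e], rule nonneg_bdd_above_summable_on)
  show "bdd_above (sum (\<lambda>j. (c j)\<^sup>2) ` {F. F \<subseteq> J \<and> finite F})"
    by (rule bdd_aboveI2[where M = "(K * norm x)\<^sup>2"])
       (auto intro: dominated_square_sum_le[OF f _ _ c])
qed auto

lemma dominated_expansion_norm_le:
  assumes e: "orthonormal_family J e" and f: "orthonormal_family J f"
    and s: "((\<lambda>j. c j *\<^sub>R e j) has_sum s) J"
    and c: "\<And>j. j \<in> J \<Longrightarrow> \<bar>c j\<bar> \<le> K * \<bar>x \<bullet> f j\<bar>" and K: "0 \<le> K"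
  shows "norm s \<le> K * norm x"
proof (rule power2_le_imp_le)
  show "(norm s)\<^sup>2 \<le> (K * norm x)\<^sup>2"
    by (rule has_sum_le_finite_sums[OF parseval[OF e s]]) (rule dominated_square_sum_le[OF f _ _ c])
qed (use K in simp)

lemma has_sum_diff:
  fixes f g :: "'i \<Rightarrow> 'a::topological_ab_group_add"
  assumes "(f has_sum a) A" "(g has_sum b) A"
  shows "((\<lambda>x. f x - g x) has_sum a - b) A"
  using has_sum_add[OF assms(1), of "\<lambda>x. - g x" "- b"] assms(2) by (simp add: has_sum_uminus)

section \<open>Residuals of diagonal operators\<close>

lemma diagonal_op_exists:
  fixes v :: "nat \<Rightarrow> 'a::{real_inner, complete_space}"
  assumes v: "orthonormal_family J v" and K: "\<And>j. j \<in> J \<Longrightarrow> \<bar>w j\<bar> \<le> K" "0 \<le> K"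
  shows "\<exists>W. diagonal_op J v w W"
proof -
  define T where "T x = (\<Sum>\<^sub>\<infinity>j\<in>J. (w j * (x \<bullet> v j)) *\<^sub>R v j)" for x
  have bd: "\<bar>w j * (x \<bullet> v j)\<bar> \<le> K * \<bar>x \<bullet> v j\<bar>" if "j \<in> J" for j x
    using K that by (simp add: abs_mult mult_right_mono)
  have T: "((\<lambda>j. (w j * (x \<bullet> v j)) *\<^sub>R v j) has_sum T x) J" for x
    unfolding T_def using dominated_expansion_summable[OF v v bd] by (simp add: summable_iff_has_sum_infsum)
  have "bounded_linear T"
  proof (rule bounded_linear_intro)
    fix x y :: 'a and r :: real
    have "((\<lambda>j. (w j * ((x + y) \<bullet> v j)) *\<^sub>R v j) has_sum T x + T y) J"
      using has_sum_add[OF T[of x] T[of y]] by (simp add: inner_add_left algebra_simps)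
    then show "T (x + y) = T x + T y"
      using T has_sum_unique by blast
    have "((\<lambda>j. (w j * ((r *\<^sub>R x) \<bullet> v j)) *\<^sub>R v j) has_sum r *\<^sub>R T x) J"
      using has_sum_scaleR[OF T[of x], of r] by (simp add: mult_ac)
    then show "T (r *\<^sub>R x) = r *\<^sub>R T x"
      using T has_sum_unique by blast
    show "norm (T x) \<le> norm x * K"
      using dominated_expansion_norm_le[OF v v T bd K(2)] by (simp add: mult.commute)
  qed
  then have "blinfun_apply (Blinfun T) = T"
    by (rule bounded_linear_Blinfun_apply)
  then show ?thesis
    using T unfolding diagonal_op_def by metis
qed

lemma residual_expansion:
  fixes v :: "nat \<Rightarrow> 'a::{real_inner, complete_space}"
  assumes v: "orthonormal_family J v" and W: "diagonal_op J v w W"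
  shows "((\<lambda>j. max 0 (w j * (x \<bullet> v j)) *\<^sub>R v j) has_sum residual J v W x) J"
proof -
  have coeff: "v j \<bullet> blinfun_apply W x = w j * (x \<bullet> v j)" if "j \<in> J" for j
    using orthonormal_expansion_coeff[OF v _ that] W
    unfolding diagonal_op_def by (metis inner_commute)
  have "(\<lambda>j. max 0 (v j \<bullet> blinfun_apply W x) *\<^sub>R v j) summable_on J"
    by (rule dominated_expansion_summable[OF v v, where K = 1 and x = "blinfun_apply W x"])
       (auto simp: inner_commute)
  then have "((\<lambda>j. max 0 (v j \<bullet> blinfun_apply W x) *\<^sub>R v j) has_sum residual J v W x) J"
    unfolding residual_def relu_def by simp
  then show ?thesis
    by (rule has_sum_cong[THEN iffD1, rotated]) (simp add: coeff)
qed

text \<open>The ReLU is 1-Lipschitz in each coefficient, so weights bounded by \<open>L\<close> suffice. For the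
  converse, moving from \<open>0\<close> to \<open>v k\<close> detects the positive part of \<open>w k\<close>, and moving from \<open>0\<close> to
  \<open>- v k\<close> the negative part.\<close>

lemma residual_lipschitz_iff:
  fixes v :: "nat \<Rightarrow> 'a::{real_inner, complete_space}"
  assumes v: "orthonormal_family J v" and W: "diagonal_op J v w W" and L: "0 \<le> L"
  shows "L-lipschitz_on UNIV (residual J v W) \<longleftrightarrow> (\<forall>j\<in>J. \<bar>w j\<bar> \<le> L)"
proof
  assume lip: "L-lipschitz_on UNIV (residual J v W)"
  note res = residual_expansion[OF v W]
  show "\<forall>j\<in>J. \<bar>w j\<bar> \<le> L"
  proof
    fix k assume k: "k \<in> J"
    have vk: "v k \<bullet> v k = 1"
      using v k by (simp add: orthonormal_family_def)
    then have nk: "norm (v k) = 1"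
      by (simp add: norm_eq_sqrt_inner)
    have bd: "max 0 (w k * r) \<le> L" if "\<bar>r\<bar> = 1" for r
    proof -
      let ?d = "residual J v W (r *\<^sub>R v k) - residual J v W 0"
      have "max 0 (w k * r) = ?d \<bullet> v k"
        using orthonormal_expansion_coeff[OF v res k, of "r *\<^sub>R v k"]
          orthonormal_expansion_coeff[OF v res k, of 0]
        by (simp add: inner_diff_left vk)
      also have "\<dots> \<le> norm ?d"
        using norm_cauchy_schwarz[of ?d "v k"] nk by simp
      also have "\<dots> \<le> L"
        using lipschitz_onD[OF lip, of "r *\<^sub>R v k" 0] that nk by (simp add: dist_norm)
      finally show ?thesis .
    qed
    show "\<bar>w k\<bar> \<le> L"
      using bd[of 1] bd[of "-1"] by (simp add: abs_le_iff)
  qed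
next
  assume w: "\<forall>j\<in>J. \<bar>w j\<bar> \<le> L"
  note res = residual_expansion[OF v W]
  show "L-lipschitz_on UNIV (residual J v W)"
  proof (rule lipschitz_onI)
    fix x y
    have "((\<lambda>j. (max 0 (w j * (x \<bullet> v j)) - max 0 (w j * (y \<bullet> v j))) *\<^sub>R v j) has_sum
            (residual J v W x - residual J v W y)) J"
      using has_sum_diff[OF res[of x] res[of y]] by (simp add: algebra_simps)
    moreover have "\<bar>max 0 (w j * (x \<bullet> v j)) - max 0 (w j * (y \<bullet> v j))\<bar> \<le> L * \<bar>(x - y) \<bullet> v j\<bar>"
      if "j \<in> J" for j
    proof -
      have "\<bar>max 0 (w j * (x \<bullet> v j)) - max 0 (w j * (y \<bullet> v j))\<bar>
              \<le> \<bar>w j * (x \<bullet> v j) - w j * (y \<bullet> v j)\<bar>"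
        by linarith
      also have "\<dots> = \<bar>w j\<bar> * \<bar>(x - y) \<bullet> v j\<bar>"
        by (simp add: inner_diff_left abs_mult[symmetric] algebra_simps)
      also have "\<dots> \<le> L * \<bar>(x - y) \<bullet> v j\<bar>"
        using w that by (intro mult_right_mono) auto
      finally show ?thesis .
    qed
    ultimately show "dist (residual J v W x) (residual J v W y) \<le> L * dist x y"
      unfolding dist_norm by (rule dominated_expansion_norm_le[OF v v _ _ L])
  qed (rule L)
qed

lemma bij_id_minus_contraction:
  fixes f :: "'a::{real_normed_vector, complete_space} \<Rightarrow> 'a"
  assumes f: "L-lipschitz_on UNIV f" and L: "L < 1"
  shows "bij (\<lambda>x. x - f x)"
proof -
  have "\<exists>!x. z = x - f x" for z
  proof -
    have "dist (z + f x) (z + f y) \<le> L * dist x y" for x y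
      using lipschitz_onD[OF f, of x y] by simp
    then have "\<exists>!x. z + f x = x"
      using lipschitz_on_nonneg[OF f] L by (intro banach_fix_type) auto
    then show ?thesis
      by (metis add_diff_cancel_right' diff_add_cancel)
  qed
  then show ?thesis
    unfolding bij_iff by metis
qed

section \<open>The adjoint and the normal operator\<close>

lemma singular_value_le_norm:
  assumes svd: "singular_value_decomposition \<A> J u v \<sigma>" and k: "k \<in> J"
  shows "\<sigma> k \<le> norm \<A>"
proof -
  have v: "orthonormal_family J v" and u: "orthonormal_family J u"
    and A: "\<And>x. ((\<lambda>j. (\<sigma> j * (x \<bullet> v j)) *\<^sub>R u j) has_sum blinfun_apply \<A> x) J"
    using svd by (auto simp: singular_value_decomposition_def)
  have unit: "norm (v k) = 1" "norm (u k) = 1" "v k \<bullet> v k = 1"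
    using u v k by (auto simp: orthonormal_family_def norm_eq_sqrt_inner)
  have "\<sigma> k = blinfun_apply \<A> (v k) \<bullet> u k"
    using orthonormal_expansion_coeff[OF u A k, of "v k"] unit by simp
  also have "\<dots> \<le> norm (blinfun_apply \<A> (v k))"
    using norm_cauchy_schwarz[of "blinfun_apply \<A> (v k)" "u k"] unit by simp
  also have "\<dots> \<le> norm \<A>"
    using norm_blinfun[of \<A> "v k"] unit by simp
  finally show ?thesis .
qed

text \<open>The constant \<open>adjoint\<close> is a choice, and it means nothing until some adjoint has been exhibited.
  The singular value decomposition provides one: interchange the roles of \<open>u\<close> and \<open>v\<close>.\<close>

lemma adjoint_expansion:
  fixes \<A> :: "'a::{real_inner, complete_space} \<Rightarrow>\<^sub>L 'b::{real_inner, complete_space}"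
  assumes svd: "singular_value_decomposition \<A> J u v \<sigma>"
  shows "((\<lambda>j. (\<sigma> j * (y \<bullet> u j)) *\<^sub>R v j) has_sum adjoint (blinfun_apply \<A>) y) J"
proof -
  have v: "orthonormal_family J v" and u: "orthonormal_family J u" and pos: "\<And>j. j \<in> J \<Longrightarrow> 0 < \<sigma> j"
    and A: "\<And>x. ((\<lambda>j. (\<sigma> j * (x \<bullet> v j)) *\<^sub>R u j) has_sum blinfun_apply \<A> x) J"
    using svd by (auto simp: singular_value_decomposition_def)
  define B where "B y = (\<Sum>\<^sub>\<infinity>j\<in>J. (\<sigma> j * (y \<bullet> u j)) *\<^sub>R v j)" for y
  have bd: "\<bar>\<sigma> j * (y \<bullet> u j)\<bar> \<le> norm \<A> * \<bar>y \<bullet> u j\<bar>" if "j \<in> J" for j y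
    using singular_value_le_norm[OF svd that] pos[OF that] by (simp add: abs_mult mult_right_mono)
  have B: "((\<lambda>j. (\<sigma> j * (y \<bullet> u j)) *\<^sub>R v j) has_sum B y) J" for y
    unfolding B_def using dominated_expansion_summable[OF v u bd] by (simp add: summable_iff_has_sum_infsum)
  have "blinfun_apply \<A> x \<bullet> y = x \<bullet> B y" for x y
  proof -
    have "((\<lambda>j. (\<sigma> j * (x \<bullet> v j)) *\<^sub>R u j \<bullet> y) has_sum blinfun_apply \<A> x \<bullet> y) J"
      by (rule has_sum_bounded_linear[OF bounded_linear_inner_left A])
    moreover have "((\<lambda>j. x \<bullet> (\<sigma> j * (y \<bullet> u j)) *\<^sub>R v j) has_sum x \<bullet> B y) J"
      by (rule has_sum_bounded_linear[OF bounded_linear_inner_right B])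
    ultimately show ?thesis
      by (simp add: mult_ac inner_commute[of y] has_sum_unique)
  qed
  then have "adjoint (blinfun_apply \<A>) = B"
    by (intro adjoint_unique) auto
  then show ?thesis
    using B by simp
qed

lemma normal_op_expansion:
  fixes \<A> :: "'a::{real_inner, complete_space} \<Rightarrow>\<^sub>L 'b::{real_inner, complete_space}"
  assumes svd: "singular_value_decomposition \<A> J u v \<sigma>"
  shows "((\<lambda>j. ((\<sigma> j)\<^sup>2 * (x \<bullet> v j)) *\<^sub>R v j) has_sum normal_op \<A> x) J"
proof -
  have u: "orthonormal_family J u"
    and A: "((\<lambda>j. (\<sigma> j * (x \<bullet> v j)) *\<^sub>R u j) has_sum blinfun_apply \<A> x) J"
    using svd by (auto simp: singular_value_decomposition_def)
  have "blinfun_apply \<A> x \<bullet> u j = \<sigma> j * (x \<bullet> v j)" if "j \<in> J" for j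
    by (rule orthonormal_expansion_coeff[OF u A that])
  then show ?thesis
    using adjoint_expansion[OF svd, of "blinfun_apply \<A> x"] unfolding normal_op_def
    by (subst has_sum_cong[where g = "\<lambda>j. (\<sigma> j * (blinfun_apply \<A> x \<bullet> u j)) *\<^sub>R v j"])
       (auto simp: power2_eq_square)
qed

section \<open>The scalar training problem\<close>

text \<open>The contribution of one index \<open>j\<close> to \<open>N\<close> times the training loss, as a function of the weight
  \<open>w = w j\<close>: here \<open>t = 1 - (\<sigma> j)\<^sup>2\<close> and \<open>c i\<close> is the \<open>j\<close>-th coefficient of the \<open>i\<close>-th sample.\<close>

definition component_loss :: "'i set \<Rightarrow> real \<Rightarrow> ('i \<Rightarrow> real) \<Rightarrow> real \<Rightarrow> real" where
  "component_loss I t c w = (\<Sum>i\<in>I. (t * c i - max 0 (w * c i))\<^sup>2)"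

text \<open>Minimality holds for each sample separately. If \<open>c \<ge> 0\<close>, then \<open>max 0 w\<close> is at most \<open>L\<close>, and
  \<open>min t L\<close> is the point of \<open>[0, L]\<close> closest to \<open>t\<close>. If \<open>c < 0\<close>, the weight \<open>min t L\<close> switches the
  ReLU off, and any active ReLU moves further away from the nonpositive target \<open>t * c\<close>.\<close>

lemma sample_term_minimal:
  fixes t L w c :: real
  assumes "0 \<le> t" "\<bar>w\<bar> \<le> L"
  shows "(t * c - max 0 (min t L * c))\<^sup>2 \<le> (t * c - max 0 (w * c))\<^sup>2"
proof (cases "c \<ge> 0")
  case True
  have m: "max 0 (r * c) = max 0 r * c" for r
    using True by (simp add: max_def mult_le_0_iff zero_le_mult_iff)
  have "\<bar>t - max 0 (min t L)\<bar> \<le> \<bar>t - max 0 w\<bar>"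
    using assms by linarith
  then have "(t - max 0 (min t L))\<^sup>2 * c\<^sup>2 \<le> (t - max 0 w)\<^sup>2 * c\<^sup>2"
    by (intro mult_right_mono) (simp_all add: abs_le_square_iff)
  then show ?thesis
    unfolding m by (simp add: power_mult_distrib[symmetric] left_diff_distrib)
next
  case False
  moreover have "0 \<le> min t L"
    using assms by linarith
  ultimately have "min t L * c \<le> 0" "t * c \<le> 0"
    using assms(1) by (auto simp: mult_le_0_iff)
  then have "\<bar>t * c - max 0 (min t L * c)\<bar> \<le> \<bar>t * c - max 0 (w * c)\<bar>"
    by linarith
  then show ?thesis
    by (simp add: abs_le_square_iff)
qed

lemma component_loss_minimal:
  assumes "0 \<le> t" "\<bar>w\<bar> \<le> L"
  shows "component_loss I t c (min t L) \<le> component_loss I t c w"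
  unfolding component_loss_def by (intro sum_mono sample_term_minimal assms)

text \<open>Since \<open>min t L\<close> is optimal for every sample, a minimizer must attain the optimum on each of
  them. A sample with \<open>c i > 0\<close> then forces \<open>max 0 w = min t L\<close>. If \<open>w < 0\<close>, this gives
  \<open>min t L = 0\<close> with \<open>L > 0\<close>, so the target is zero, and a sample with \<open>c i < 0\<close> would see
  the active ReLU.\<close>

lemma component_loss_minimizers:
  assumes I: "finite I" and t: "0 \<le> t" and w: "\<bar>w\<bar> \<le> L"
    and pos: "\<exists>i\<in>I. 0 < c i"
    and le: "component_loss I t c w \<le> component_loss I t c (min t L)"
  shows "w = min t L \<or> w < 0 \<and> t = 0 \<and> 0 < L \<and> (\<forall>i\<in>I. 0 \<le> c i)"
proof -
  have eq: "(t * c i - max 0 (min t L * c i))\<^sup>2 = (t * c i - max 0 (w * c i))\<^sup>2" if "i \<in> I" for i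
  proof (rule ccontr)
    assume "\<not> ?thesis"
    then have "(t * c i - max 0 (min t L * c i))\<^sup>2 < (t * c i - max 0 (w * c i))\<^sup>2"
      using sample_term_minimal[OF t w, of "c i"] by linarith
    then have "component_loss I t c (min t L) < component_loss I t c w"
      unfolding component_loss_def using I that
      by (intro sum_strict_mono_ex1 ballI sample_term_minimal[OF t w]) auto
    with le show False by simp
  qed
  obtain i where i: "i \<in> I" "0 < c i"
    using pos by blast
  have "max 0 (r * c i) = max 0 r * c i" for r
    using i(2) by (simp add: max_def mult_le_0_iff zero_le_mult_iff)
  with eq[OF i(1)] have "((t - max 0 (min t L)) * c i)\<^sup>2 = ((t - max 0 w) * c i)\<^sup>2"
    by (simp add: left_diff_distrib)
  then have "\<bar>t - max 0 (min t L)\<bar> = \<bar>t - max 0 w\<bar>"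
    using i(2) by (simp add: power_mult_distrib power2_eq_iff) linarith
  then have w0: "max 0 w = min t L"
    using t w by linarith
  show ?thesis
  proof (cases "w < 0")
    case True
    with w0 w have tL: "t = 0" "0 < L"
      using t by linarith+
    have "0 \<le> c k" if "k \<in> I" for k
    proof (rule ccontr)
      assume "\<not> 0 \<le> c k"
      then have "0 < w * c k"
        using True by (simp add: mult_neg_neg)
      then show False
        using eq[OF that] tL by auto
    qed
    with True tL show ?thesis by blast
  qed (use w0 in auto)
qed

section \<open>Decoupling of the training loss\<close>

text \<open>The error splits into its component orthogonal to the family \<open>v\<close> and an expansion in \<open>v\<close>.
  The former is that of \<open>x\<close> itself, since the residual and the normal operator take values in the
  closed span of \<open>v\<close>; its squared norm \<open>P x\<close> is the same for all \<open>W\<close>.\<close>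

lemma sample_error_splits:
  fixes \<A> :: "'a::{real_inner, complete_space} \<Rightarrow>\<^sub>L 'b::{real_inner, complete_space}"
  assumes svd: "singular_value_decomposition \<A> J u v \<sigma>"
  obtains P where "\<And>W w x. diagonal_op J v w W \<Longrightarrow>
    ((\<lambda>j. ((1 - (\<sigma> j)\<^sup>2) * (x \<bullet> v j) - max 0 (w j * (x \<bullet> v j)))\<^sup>2) has_sum
       (norm (iresnet J v W x - normal_op \<A> x))\<^sup>2 - P x) J"
proof -
  have v: "orthonormal_family J v"
    using svd by (auto simp: singular_value_decomposition_def)
  define Q where "Q x = (\<Sum>\<^sub>\<infinity>j\<in>J. (x \<bullet> v j) *\<^sub>R v j)" for x
  have Q: "((\<lambda>j. (x \<bullet> v j) *\<^sub>R v j) has_sum Q x) J" for x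
    unfolding Q_def
    using dominated_expansion_summable[OF v v, of "\<lambda>j. x \<bullet> v j" 1 x] by simp
  have orth: "(x - Q x) \<bullet> v j = 0" if "j \<in> J" for x j
    using orthonormal_expansion_coeff[OF v Q that] by (simp add: inner_diff_left)
  show thesis
  proof (rule that[of "\<lambda>x. (norm (x - Q x))\<^sup>2"])
    fix W w x assume W: "diagonal_op J v w W"
    define d where "d j = (1 - (\<sigma> j)\<^sup>2) * (x \<bullet> v j) - max 0 (w j * (x \<bullet> v j))" for j
    define D where "D = Q x - residual J v W x - normal_op \<A> x"
    have "((\<lambda>j. (x \<bullet> v j) *\<^sub>R v j - max 0 (w j * (x \<bullet> v j)) *\<^sub>R v j
             - ((\<sigma> j)\<^sup>2 * (x \<bullet> v j)) *\<^sub>R v j) has_sum D) J"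
      unfolding D_def
      by (intro has_sum_diff Q residual_expansion[OF v W] normal_op_expansion[OF svd])
    then have D: "((\<lambda>j. d j *\<^sub>R v j) has_sum D) J"
      by (simp add: d_def algebra_simps)
    have "((\<lambda>j. (x - Q x) \<bullet> (d j *\<^sub>R v j)) has_sum (x - Q x) \<bullet> D) J"
      by (rule has_sum_bounded_linear[OF bounded_linear_inner_right D])
    moreover have "((\<lambda>j. (x - Q x) \<bullet> (d j *\<^sub>R v j)) has_sum 0) J"
      by (rule has_sum_0) (simp add: orth)
    ultimately have "orthogonal (x - Q x) D"
      unfolding orthogonal_def by (rule has_sum_unique)
    then have "(norm ((x - Q x) + D))\<^sup>2 = (norm (x - Q x))\<^sup>2 + (norm D)\<^sup>2"
      by (rule norm_add_Pythagorean)
    moreover have "(x - Q x) + D = iresnet J v W x - normal_op \<A> x"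
      by (simp add: D_def iresnet_def)
    ultimately show "((\<lambda>j. ((1 - (\<sigma> j)\<^sup>2) * (x \<bullet> v j) - max 0 (w j * (x \<bullet> v j)))\<^sup>2) has_sum
       (norm (iresnet J v W x - normal_op \<A> x))\<^sup>2 - (norm (x - Q x))\<^sup>2) J"
      using parseval[OF v D] by (simp add: d_def)
  qed
qed

lemma has_sum_finite_sum:
  fixes f :: "'i \<Rightarrow> 'j \<Rightarrow> 'a::topological_comm_monoid_add"
  assumes "finite I" "\<And>i. i \<in> I \<Longrightarrow> (f i has_sum s i) A"
  shows "((\<lambda>j. \<Sum>i\<in>I. f i j) has_sum (\<Sum>i\<in>I. s i)) A"
  using assms by (induction I rule: finite_induct) (auto intro!: has_sum_add)

text \<open>In this form two admissible operators are compared index by index, since \<open>has_sum\<close> is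
  monotone, and strictly so if one term is strictly smaller.\<close>

lemma training_loss_splits:
  fixes \<A> :: "'a::{real_inner, complete_space} \<Rightarrow>\<^sub>L 'b::{real_inner, complete_space}"
  assumes svd: "singular_value_decomposition \<A> J u v \<sigma>"
  obtains C S where
    "\<And>W w. diagonal_op J v w W \<Longrightarrow>
      ((\<lambda>j. component_loss {1..N} (1 - (\<sigma> j)\<^sup>2) (\<lambda>i. xs i \<bullet> v j) (w j)) has_sum S W) J"
    "\<And>W. training_loss \<A> J v N xs W = (1 / real N) * (C + S W)"
proof -
  obtain P where P: "\<And>W w x. diagonal_op J v w W \<Longrightarrow>
    ((\<lambda>j. ((1 - (\<sigma> j)\<^sup>2) * (x \<bullet> v j) - max 0 (w j * (x \<bullet> v j)))\<^sup>2) has_sum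
       (norm (iresnet J v W x - normal_op \<A> x))\<^sup>2 - P x) J"
    using sample_error_splits[OF svd] by blast
  show thesis
  proof (rule that)
    show "training_loss \<A> J v N xs W = (1 / real N) * ((\<Sum>i=1..N. P (xs i)) +
            (\<Sum>i=1..N. (norm (iresnet J v W (xs i) - normal_op \<A> (xs i)))\<^sup>2 - P (xs i)))" for W
      by (simp add: training_loss_def sum_subtractf)
  qed (auto simp: component_loss_def intro!: has_sum_finite_sum P)
qed

section \<open>Inversion\<close>

text \<open>The inverse is read off coefficientwise from the fixed point equation \<open>x = z + residual x\<close>,
  which shows in particular that \<open>x\<close> has an expansion in \<open>v\<close> as soon as \<open>z\<close> has one. A weight other
  than \<open>min (1 - (\<sigma> j)\<^sup>2) L\<close> does no harm if it is nonpositive, the filter value is \<open>1\<close> (that is,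
  \<open>\<sigma> j = 1\<close>), and the coefficient of \<open>z\<close> lies on the half-line where the ReLU is off.\<close>

lemma inverse_formula_if:
  fixes v :: "nat \<Rightarrow> 'a::{real_inner, complete_space}"
  assumes v: "orthonormal_family J v" and W: "diagonal_op J v w W"
    and L: "0 \<le> L" "L < 1"
    and bij: "bij (iresnet J v W)"
    and z: "((\<lambda>j. a j *\<^sub>R v j) has_sum z) J"
    and \<sigma>: "\<And>j. j \<in> J \<Longrightarrow> 0 < \<sigma> j \<and> \<sigma> j \<le> 1"
    and w: "\<And>j. j \<in> J \<Longrightarrow>
      w j = min (1 - (\<sigma> j)\<^sup>2) L \<or> w j \<le> 0 \<and> \<sigma> j = 1 \<and> 0 \<le> z \<bullet> v j"
  shows "inverse_formula J v \<sigma> L W z"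
proof -
  define x where "x = inv (iresnet J v W) z"
  have "iresnet J v W x = z"
    unfolding x_def by (rule surj_f_inv_f[OF bij_is_surj[OF bij]])
  then have xz: "z + residual J v W x = x"
    by (simp add: iresnet_def algebra_simps)
  have x: "((\<lambda>j. (a j + max 0 (w j * (x \<bullet> v j))) *\<^sub>R v j) has_sum x) J"
    using has_sum_add[OF z residual_expansion[OF v W, of x]] by (simp add: xz scaleR_add_left)
  have "a j + max 0 (w j * (x \<bullet> v j)) = r_filter L ((\<sigma> j)\<^sup>2) (z \<bullet> v j) * (z \<bullet> v j)" if j: "j \<in> J" for j
  proof -
    define c s where "c = x \<bullet> v j" and "s = z \<bullet> v j"
    have c: "c = s + max 0 (w j * c)" "a j = s"
      using orthonormal_expansion_coeff[OF v x j] orthonormal_expansion_coeff[OF v z j]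
      by (simp_all add: c_def s_def)
    have "(\<sigma> j)\<^sup>2 \<le> 1" "0 < (\<sigma> j)\<^sup>2"
      using \<sigma>[OF j] by (auto simp: power_le_one)
    then have wj: "w j = min (1 - (\<sigma> j)\<^sup>2) L \<or> w j \<le> 0 \<and> (\<sigma> j)\<^sup>2 = 1 \<and> 0 \<le> s" "w j < 1"
      using w[OF j] L by (auto simp: s_def)
    have "c = r_filter L ((\<sigma> j)\<^sup>2) s * s"
    proof (cases "0 \<le> s")
      case True
      have "0 \<le> c"
        using c(1) True by linarith
      have "max ((\<sigma> j)\<^sup>2) (1 - L) * c = s"
      proof (cases "w j \<le> 0")
        \<comment> \<open>Both alternatives for \<open>w j\<close> meet here: \<open>w j = 0\<close> as the optimal weight means
          \<open>\<sigma> j = 1\<close> or \<open>L = 0\<close>, and in every case the maximum is \<open>1\<close>.\<close>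
        case True
        then have "w j * c \<le> 0"
          using \<open>0 \<le> c\<close> by (simp add: mult_nonpos_nonneg)
        moreover have "max ((\<sigma> j)\<^sup>2) (1 - L) = 1"
          using wj True L \<open>(\<sigma> j)\<^sup>2 \<le> 1\<close> by linarith
        ultimately show ?thesis
          using c(1) by simp
      next
        case False
        then have "max 0 (w j * c) = w j * c"
          using \<open>0 \<le> c\<close> by simp
        moreover have "max ((\<sigma> j)\<^sup>2) (1 - L) = 1 - w j"
          using wj False by linarith
        ultimately show ?thesis
          using c(1) by (simp add: left_diff_distrib)
      qed
      moreover have "max ((\<sigma> j)\<^sup>2) (1 - L) > 0"
        using \<open>0 < (\<sigma> j)\<^sup>2\<close> by linarith
      ultimately show ?thesis
        using True by (simp add: r_filter_def field_simps)
    next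
      case False
      then have "0 \<le> w j"
        using wj L \<open>(\<sigma> j)\<^sup>2 \<le> 1\<close> by auto
      moreover have "c < 0"
      proof (rule ccontr)
        assume "\<not> c < 0"
        then have "max 0 (w j * c) \<le> c"
          using wj(2) mult_right_mono[of "w j" 1 c] by simp
        then show False
          using c(1) False by linarith
      qed
      ultimately have "w j * c \<le> 0"
        by (simp add: mult_nonneg_nonpos)
      then show ?thesis
        using c(1) False by (simp add: r_filter_def)
    qed
    then show ?thesis
      using c by (simp add: c_def s_def)
  qed
  then show ?thesis
    unfolding inverse_formula_def using x by (subst has_sum_cong) (auto simp: x_def)
qed

section \<open>Solutions of the training problem\<close>

theorem lemma4p4:
  fixes \<A> :: "'a::{real_inner, complete_space} \<Rightarrow>\<^sub>L 'b::{real_inner, complete_space}"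
    and J :: "nat set" and u :: "nat \<Rightarrow> 'b" and v :: "nat \<Rightarrow> 'a" and \<sigma> :: "nat \<Rightarrow> real"
    and L :: real and N :: nat and xs :: "nat \<Rightarrow> 'a" and wopt :: "nat \<Rightarrow> real"
  assumes norm_A: "norm \<A> = 1"
    and svd: "singular_value_decomposition \<A> J u v \<sigma>"
    and L: "0 \<le> L" "L < 1"
    and data: "\<And>j. j \<in> J \<Longrightarrow> \<exists>i\<in>{1..N}. xs i \<bullet> v j > 0"
    and wopt: "\<And>j. wopt j = min (1 - (\<sigma> j)\<^sup>2) L"
  shows
    "(\<exists>W. diagonal_op J v wopt W \<and>
          solves_training \<A> J v L N xs W \<and>
          bij (iresnet J v W) \<and>
          (\<forall>z \<in> range (adjoint (blinfun_apply \<A>)). inverse_formula J v \<sigma> L W z)) \<and>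
     (undetermined J v \<sigma> L N xs = {} \<longrightarrow>
        (\<forall>W. solves_training \<A> J v L N xs W \<longrightarrow>
           diagonal_op J v wopt W \<and>
           bij (iresnet J v W) \<and>
           (\<forall>z \<in> range (adjoint (blinfun_apply \<A>)). inverse_formula J v \<sigma> L W z))) \<and>
     (\<forall>W w. solves_training \<A> J v L N xs W \<and> diagonal_op J v w W \<longrightarrow>
        bij (iresnet J v W) \<and>
        (\<forall>j \<in> J - undetermined J v \<sigma> L N xs. w j = wopt j) \<and>
        (\<forall>j \<in> undetermined J v \<sigma> L N xs. w j \<in> {-L..0}) \<and>
        (\<forall>z \<in> range (adjoint (blinfun_apply \<A>)).
           (\<forall>j \<in> undetermined J v \<sigma> L N xs. 0 \<le> z \<bullet> v j) \<longrightarrow> inverse_formula J v \<sigma> L W z))"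
proof -
  let ?A = "blinfun_apply \<A>" and ?U = "undetermined J v \<sigma> L N xs"
  have v: "orthonormal_family J v" and pos: "\<And>j. j \<in> J \<Longrightarrow> 0 < \<sigma> j"
    using svd by (auto simp: singular_value_decomposition_def)
  have \<sigma>: "\<sigma> j \<le> 1" if "j \<in> J" for j
    using singular_value_le_norm[OF svd that] norm_A by simp
  have t: "0 \<le> 1 - (\<sigma> j)\<^sup>2" if "j \<in> J" for j
    using pos[OF that] \<sigma>[OF that] by (simp add: power_le_one)
  have wopt_bd: "\<bar>wopt j\<bar> \<le> L" if "j \<in> J" for j
    using t[OF that] L unfolding wopt by linarith
  let ?loss = "\<lambda>j. component_loss {1..N} (1 - (\<sigma> j)\<^sup>2) (\<lambda>i. xs i \<bullet> v j)"
  obtain C S where S: "\<And>W w. diagonal_op J v w W \<Longrightarrow> ((\<lambda>j. ?loss j (w j)) has_sum S W) J"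
    and loss: "\<And>W. training_loss \<A> J v N xs W = (1 / real N) * (C + S W)"
    by (rule training_loss_splits[OF svd, where N = N and xs = xs]) (rule that)
  obtain Wopt where Wopt: "diagonal_op J v wopt Wopt"
    using diagonal_op_exists[OF v _ L(1), where w = wopt] wopt_bd by blast
  have feasible: "L-lipschitz_on UNIV (residual J v Wopt)"
    using residual_lipschitz_iff[OF v Wopt L(1)] wopt_bd by blast
  have solves: "solves_training \<A> J v L N xs Wopt"
    unfolding solves_training_def is_arg_min_def
  proof (intro conjI notI)
    assume "\<exists>W. (W \<in> parameters J v \<and> L-lipschitz_on UNIV (residual J v W)) \<and>
      training_loss \<A> J v N xs W < training_loss \<A> J v N xs Wopt"
    then obtain W w where W: "diagonal_op J v w W" "L-lipschitz_on UNIV (residual J v W)"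
      and less: "training_loss \<A> J v N xs W < training_loss \<A> J v N xs Wopt"
      by (auto simp: parameters_def)
    have "S Wopt \<le> S W"
    proof (rule has_sum_mono[OF S[OF Wopt] S[OF W(1)]])
      fix j assume "j \<in> J"
      then show "?loss j (wopt j) \<le> ?loss j (w j)"
        using residual_lipschitz_iff[OF v W(1) L(1)] W(2) t L(1)
        unfolding wopt by (intro component_loss_minimal) auto
    qed
    then have "training_loss \<A> J v N xs Wopt \<le> training_loss \<A> J v N xs W"
      unfolding loss by (intro mult_left_mono) auto
    with less show False by simp
  qed (use Wopt feasible in \<open>auto simp: parameters_def\<close>)
  have minimizer: "bij (iresnet J v W)"
      "j \<in> J \<Longrightarrow> w j = wopt j \<or> j \<in> ?U \<and> w j < 0 \<and> - L \<le> w j"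
    if sol: "solves_training \<A> J v L N xs W" and W: "diagonal_op J v w W" for W w j
  proof -
    have lip: "L-lipschitz_on UNIV (residual J v W)"
      and "training_loss \<A> J v N xs W \<le> training_loss \<A> J v N xs Wopt"
      using sol Wopt feasible unfolding solves_training_def is_arg_min_def parameters_def
      by (auto simp: not_less)
    note le = this(2)
    show "bij (iresnet J v W)"
      using bij_id_minus_contraction[OF lip L(2)] by (simp add: iresnet_def[abs_def])
    have w: "\<bar>w j\<bar> \<le> L" if "j \<in> J" for j
      using residual_lipschitz_iff[OF v W L(1)] lip that by blast
    assume j: "j \<in> J"
    \<comment> \<open>With \<open>N = 0\<close> the loss would be constant, since its prefactor is \<open>1 / 0 = 0\<close>.\<close>
    then have "0 < N"
      using data[OF j] by auto
    then have "S W \<le> S Wopt"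
      using le by (simp add: loss divide_le_cancel)
    have min: "?loss k (wopt k) \<le> ?loss k (w k)" if "k \<in> J" for k
      unfolding wopt by (rule component_loss_minimal[OF t[OF that] w[OF that]])
    have "?loss j (w j) \<le> ?loss j (wopt j)"
    proof (rule ccontr)
      assume "\<not> ?thesis"
      then have less: "?loss j (wopt j) < ?loss j (w j)"
        by (rule not_le_imp_less)
      have "S Wopt < S W"
        by (rule has_sum_strict_mono[OF S[OF Wopt] S[OF W]]) (fact min j less)+
      with \<open>S W \<le> S Wopt\<close> show False by simp
    qed
    then have "w j = wopt j \<or>
        w j < 0 \<and> 1 - (\<sigma> j)\<^sup>2 = 0 \<and> 0 < L \<and> (\<forall>i\<in>{1..N}. 0 \<le> xs i \<bullet> v j)"
      unfolding wopt using t[OF j] w[OF j] data[OF j]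
      by (intro component_loss_minimizers) auto
    moreover have "1 - (\<sigma> j)\<^sup>2 = 0 \<longleftrightarrow> \<sigma> j = 1"
      using pos[OF j] by (simp add: power2_eq_1_iff)
    ultimately show "w j = wopt j \<or> j \<in> ?U \<and> w j < 0 \<and> - L \<le> w j"
      using j w[OF j] by (auto simp: undetermined_def)
  qed
  have formula: "inverse_formula J v \<sigma> L W z"
    if sol: "solves_training \<A> J v L N xs W" and W: "diagonal_op J v w W"
      and z: "z \<in> range (adjoint ?A)" and "\<forall>j\<in>J. w j = wopt j \<or> 0 \<le> z \<bullet> v j" for W w z
  proof -
    obtain y where y: "z = adjoint ?A y"
      using z by blast
    show ?thesis
    proof (rule inverse_formula_if[OF v W L minimizer(1)[OF sol W]])
      show "((\<lambda>j. (\<sigma> j * (y \<bullet> u j)) *\<^sub>R v j) has_sum z) J"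
        unfolding y by (rule adjoint_expansion[OF svd])
    next
      fix j assume j: "j \<in> J"
      show "0 < \<sigma> j \<and> \<sigma> j \<le> 1"
        using pos \<sigma> j by simp
      show "w j = min (1 - (\<sigma> j)\<^sup>2) L \<or> w j \<le> 0 \<and> \<sigma> j = 1 \<and> 0 \<le> z \<bullet> v j"
        using minimizer(2)[OF sol W j] that(4) j by (auto simp: wopt undetermined_def)
    qed
  qed
  have minimizer_opt: "diagonal_op J v wopt W"
    if "diagonal_op J v w W" "\<forall>j\<in>J. w j = wopt j" for W w
  proof -
    have "((\<lambda>j. (w j * (x \<bullet> v j)) *\<^sub>R v j) has_sum blinfun_apply W x) J \<longleftrightarrow>
          ((\<lambda>j. (wopt j * (x \<bullet> v j)) *\<^sub>R v j) has_sum blinfun_apply W x) J" for x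
      by (rule has_sum_cong) (simp add: that(2))
    then show ?thesis
      using that(1) by (simp add: diagonal_op_def)
  qed
  show ?thesis
  proof (intro conjI allI impI)
    show "\<exists>W. diagonal_op J v wopt W \<and> solves_training \<A> J v L N xs W \<and> bij (iresnet J v W) \<and>
            (\<forall>z \<in> range (adjoint ?A). inverse_formula J v \<sigma> L W z)"
      using Wopt solves minimizer(1)[OF solves Wopt] formula[OF solves Wopt] by blast
  next
    fix W assume U: "?U = {}" and sol: "solves_training \<A> J v L N xs W"
    then obtain w where W: "diagonal_op J v w W"
      by (auto simp: solves_training_def is_arg_min_def parameters_def)
    have w: "\<forall>j\<in>J. w j = wopt j"
      using minimizer(2)[OF sol W] U by auto
    show "diagonal_op J v wopt W"
      using minimizer_opt[OF W w] .
    show "bij (iresnet J v W)"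
      by (rule minimizer(1)[OF sol W])
    show "\<forall>z \<in> range (adjoint ?A). inverse_formula J v \<sigma> L W z"
      using formula[OF sol W] w by blast
  next
    fix W w assume "solves_training \<A> J v L N xs W \<and> diagonal_op J v w W"
    then have sol: "solves_training \<A> J v L N xs W" and W: "diagonal_op J v w W"
      by auto
    show "bij (iresnet J v W)"
      by (rule minimizer(1)[OF sol W])
    show "\<forall>j \<in> J - ?U. w j = wopt j"
      using minimizer(2)[OF sol W] by blast
    show "\<forall>j \<in> ?U. w j \<in> {- L..0}"
    proof
      fix j assume j: "j \<in> ?U"
      then have "j \<in> J" "wopt j = 0"
        using L by (auto simp: undetermined_def wopt)
      then show "w j \<in> {- L..0}"
        using minimizer(2)[OF sol W, of j] L by auto
    qed
    show "\<forall>z \<in> range (adjoint ?A). (\<forall>j \<in> ?U. 0 \<le> z \<bullet> v j) \<longrightarrow> inverse_formula J v \<sigma> L W z"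
      using formula[OF sol W] minimizer(2)[OF sol W] by blast
  qed
qed

end
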